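(* For the generic BAR model, the map $\mathbf{p}:\tilde\Theta\to\mathbb{R}^{2^{2p}}$, $\mathbf{p}(\tilde\theta)=\mathrm{vec}(\mathbf{P}(\tilde\theta))$, sending a parameter to its vectorized transition probability matrix, is injective: for all $(\tilde\theta,\tilde\theta')\in\tilde\Theta\times\tilde\Theta$ with $\tilde\theta\ne\tilde\theta'$ one has $\mathbf{p}(\tilde\theta)\ne\mathbf{p}(\tilde\theta')$.
   Context: Fix $p\in\mathbb{N}$, $p\ge 1$, and constants $b_{min}\in(0,1)$ and $0<\rho_{min}<\rho_{max}<1$. Let $\mathbf{1}$ be the all-ones vector in $\mathbb{R}^p$. Parameter space: $\tilde\Theta$ is the set of $\tilde\theta=(\mathbf{A},\tilde{\mathbf{A}},\mathbf{b},\rho_w)$ with $\mathbf{A}=(a_{ij}),\tilde{\mathbf{A}}=(\tilde a_{ij})\in\mathbb{R}^{p\times p}$, $\mathbf{b},\rho_w\in\mathbb{R}^p$ such that for all $i,j\in\{1,\dots,p\}$: $\sum_{j=1}^p(a_{ij}+\tilde a_{ij})+b_i=1$, $b_i\ge b_{min}$, $\rho_{w_i}\in[\rho_{min},\rho_{max}]$, $a_{ij}\ge 0$, $\tilde a_{ij}\ge0$, and $a_{ij}\tilde a_{ij}=0$. The $i$-th rows of $\mathbf{A}$ and $\tilde{\mathbf{A}}$ are denoted $\mathbf{a}_i^\top$ and $\tilde{\mathbf{a}}_i^\top$. Generic BAR model with parameter $\tilde\theta\in\tilde\Theta$: a Markov chain $\{\mathbf{X}(k)\}_{k\ge0}$ on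 $\{0,1\}^p$ with $$X_i(k+1)\sim\mathrm{Ber}\left(\mathbf{a}_i^\top\mathbf{X}(k)+\tilde{\mathbf{a}}_i^\top(\mathbf{1}-\mathbf{X}(k))+b_iW_i(k+1)\right),\quad i=1,\dots,p,$$ where $W_i(k+1)\sim\mathrm{Ber}(\rho_{w_i})$, $i=1,\dots,p$, are independent noise variables, independent of $\mathbf{X}(t)$ for all $t<k+1$, and the entries of $\mathbf{X}(k+1)$ are conditionally independent given $\mathbf{X}(k)$. Its transition probability matrix $\mathbf{P}(\tilde\theta)=(p_{\mathbf{u}\mathbf{v}}(\tilde\theta))_{\mathbf{u},\mathbf{v}\in\{0,1\}^p}\in\mathbb{R}^{2^p\times 2^p}$ therefore has entries $$p_{\mathbf{u}\mathbf{v}}(\tilde\theta)=\prod_{i=1}^p q_i(\mathbf{u})^{v_i}(1-q_i(\mathbf{u}))^{1-v_i},\qquad q_i(\mathbf{u})=\mathbf{a}_i^\top\mathbf{u}+\tilde{\mathbf{a}}_i^\top(\mathbf{1}-\mathbf{u})+\rho_{w_i}b_i.$$ $\mathrm{vec}(\cdot)$ denotes vectorization of a matrix. *)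

theory Defs
  imports "HOL-Analysis.Analysis" "HOL-Probability.Product_PMF"
begin

text \<open>
  The index type \<open>'p\<close> plays the role of \<open>{1, \<dots>, p}\<close>, i.e. \<open>p = CARD('p)\<close>. A parameter is
  a tuple \<open>(A, A', b, \<rho>)\<close>, where \<open>A'\<close> is the matrix usually written with a tilde; \<open>A $ i\<close> is
  the \<open>i\<close>-th row of \<open>A\<close>.
\<close>

type_synonym 'p bar_param = "(real ^ 'p ^ 'p) \<times> (real ^ 'p ^ 'p) \<times> (real ^ 'p) \<times> (real ^ 'p)"

definition bar_param_space :: "real \<Rightarrow> real \<Rightarrow> real \<Rightarrow> 'p::finite bar_param set" where
  "bar_param_space bmin rmin rmax = {(A, A', b, \<rho>).
     (\<forall>i. (\<Sum>j\<in>UNIV. A $ i $ j + A' $ i $ j) + b $ i = 1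
        \<and> b $ i \<ge> bmin \<and> \<rho> $ i \<in> {rmin..rmax})
     \<and> (\<forall>i j. A $ i $ j \<ge> 0 \<and> A' $ i $ j \<ge> 0 \<and> A $ i $ j * A' $ i $ j = 0)}"

text \<open>The states \<open>{0,1}\<^sup>p\<close> are the elements of \<open>bool ^ 'p\<close>, embedded into \<open>real ^ 'p\<close> as follows.\<close>

definition state_vec :: "bool ^ 'p \<Rightarrow> real ^ 'p" where
  "state_vec u = (\<chi> i. of_bool (u $ i))"

text \<open>
  Conditional law of \<open>X(k+1)\<close> given \<open>X(k) = u\<close>: the coordinates are independent, and the
  \<open>i\<close>-th one is obtained by first drawing the noise \<open>w = W\<^sub>i(k+1)\<close>. Outside \<open>[0,1]\<close> the argument
  of \<^const>\<open>bernoulli_pmf\<close> is clamped, which never happens on the parameter space (see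
  \<open>bar_success_bounds\<close>).
\<close>

definition bar_success :: "'p::finite bar_param \<Rightarrow> bool ^ 'p \<Rightarrow> 'p \<Rightarrow> bool \<Rightarrow> real" where
  "bar_success \<theta> u i w = (case \<theta> of (A, A', b, \<rho>) \<Rightarrow>
     A $ i \<bullet> state_vec u + A' $ i \<bullet> (1 - state_vec u) + b $ i * of_bool w)"

definition bar_kernel :: "'p::finite bar_param \<Rightarrow> bool ^ 'p \<Rightarrow> (bool ^ 'p) pmf" where
  "bar_kernel \<theta> u = (case \<theta> of (A, A', b, \<rho>) \<Rightarrow>
     map_pmf vec_lambda (Pi_pmf UNIV False (\<lambda>i.
       bind_pmf (bernoulli_pmf (\<rho> $ i)) (\<lambda>w. bernoulli_pmf (bar_success \<theta> u i w)))))"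

definition bar_transition_matrix :: "'p::finite bar_param \<Rightarrow> real ^ (bool ^ 'p) ^ (bool ^ 'p)" where
  "bar_transition_matrix \<theta> = (\<chi> u v. pmf (bar_kernel \<theta> u) v)"

text \<open>
  Vectorization: the entries of the result are indexed by (row, column) pairs, so that for the
  transition matrix it lies in a space of dimension \<open>2\<^sup>2\<^sup>p\<close>. No linear order of the index pairs
  is fixed.
\<close>

definition vectorize :: "real ^ 'n ^ 'm \<Rightarrow> real ^ ('m \<times> 'n)" where
  "vectorize M = (\<chi> ij. M $ fst ij $ snd ij)"

definition bar_transition_vec :: "'p::finite bar_param \<Rightarrow> real ^ ((bool ^ 'p) \<times> (bool ^ 'p))" where
  "bar_transition_vec \<theta> = vectorize (bar_transition_matrix \<theta>)"

lemma DIM_bar_transition_vec: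
  "DIM(real ^ ((bool ^ 'p::finite) \<times> (bool ^ 'p))) = 2 ^ (2 * CARD('p))"
  by (simp add: card_cartesian_product flip: UNIV_Times_UNIV power_add mult_2)

lemma bar_success_bounds:
  fixes \<theta> :: "'p::finite bar_param"
  assumes "\<theta> \<in> bar_param_space bmin rmin rmax" "0 < bmin"
  shows "bar_success \<theta> u i w \<in> {0..1}"
proof -
  obtain A A' b \<rho> where \<theta>: "\<theta> = (A, A', b, \<rho>)"
    by (cases \<theta>)
  have nn: "A $ i $ j \<ge> 0" "A' $ i $ j \<ge> 0" for j
    using assms(1) unfolding bar_param_space_def \<theta> by auto
  have row: "(\<Sum>j\<in>UNIV. A $ i $ j + A' $ i $ j) + b $ i = 1" and b: "b $ i > 0"
    using assms unfolding bar_param_space_def \<theta> by (auto intro: less_le_trans)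
  define s where "s = (\<Sum>j\<in>UNIV. if u $ j then A $ i $ j else A' $ i $ j)"
  have "A $ i \<bullet> state_vec u + A' $ i \<bullet> (1 - state_vec u) = s"
    unfolding s_def inner_vec_def sum.distrib [symmetric]
    by (intro sum.cong) (auto simp: state_vec_def)
  moreover have "0 \<le> s"
    unfolding s_def by (intro sum_nonneg) (auto simp: nn)
  moreover have "s \<le> (\<Sum>j\<in>UNIV. A $ i $ j + A' $ i $ j)"
    unfolding s_def by (intro sum_mono) (auto simp: nn)
  ultimately show ?thesis
    using row b by (auto simp: bar_success_def \<theta>)
qed

text \<open>The closed form of the transition probabilities.\<close>

lemma bar_transition_matrix_entries:
  fixes A A' :: "real ^ 'p::finite ^ 'p"
  assumes "(A, A', b, \<rho>) \<in> bar_param_space bmin rmin rmax"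
    and "0 < bmin" "0 < rmin" "rmax < 1"
  defines "q \<equiv> \<lambda>u i. A $ i \<bullet> state_vec u + A' $ i \<bullet> (1 - state_vec u) + \<rho> $ i * b $ i"
  shows "bar_transition_matrix (A, A', b, \<rho>) $ u $ v =
    (\<Prod>i\<in>UNIV. q u i ^ of_bool (v $ i) * (1 - q u i) ^ (1 - of_bool (v $ i)))"
proof -
  let ?\<theta> = "(A, A', b, \<rho>)"
  let ?K = "\<lambda>i. bind_pmf (bernoulli_pmf (\<rho> $ i)) (\<lambda>w. bernoulli_pmf (bar_success ?\<theta> u i w))"
  have \<rho>: "\<rho> $ i \<in> {0..1}" for i
  proof -
    have "\<rho> $ i \<in> {rmin..rmax}"
      using assms(1) unfolding bar_param_space_def by auto
    then show ?thesis
      using assms(3,4) by auto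
  qed
  have s: "0 \<le> bar_success ?\<theta> u i w" "bar_success ?\<theta> u i w \<le> 1" for i w
    using bar_success_bounds [OF assms(1,2), of u i w] by auto
  have K: "pmf (?K i) x = q u i ^ of_bool x * (1 - q u i) ^ (1 - of_bool x)" for i x
    using \<rho> [of i] s
    by (cases x) (simp_all add: pmf_bind q_def bar_success_def algebra_simps)
  have "pmf (map_pmf vec_lambda (Pi_pmf UNIV False ?K)) (vec_lambda (vec_nth v)) =
      pmf (Pi_pmf UNIV False ?K) (vec_nth v)"
    by (intro pmf_map_inj') (auto intro: injI simp: vec_lambda_inject)
  also have "\<dots> = (\<Prod>i\<in>UNIV. pmf (?K i) (v $ i))"
    by (subst pmf_Pi) auto
  finally show ?thesis
    by (simp add: bar_transition_matrix_def bar_kernel_def K)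
qed

end

theory Submission
  imports Defs
begin

text \<open>
  The marginals of row \<open>u\<close> of the transition matrix recover the success probabilities \<open>q\<^sub>i(u)\<close>.
  Since \<open>q\<^sub>i\<close> is affine in \<open>u\<close>, its increment from \<open>0\<close> to the \<open>j\<close>-th unit vector is
  \<open>a\<^sub>i\<^sub>j - a'\<^sub>i\<^sub>j\<close>. Both entries are nonnegative and one of them vanishes, so they are the positive
  and negative part of the increment. The row sums then give \<open>b\<^sub>i\<close>, the value \<open>q\<^sub>i(0)\<close> gives
  \<open>\<rho>\<^sub>i b\<^sub>i\<close>, and \<open>b\<^sub>i > 0\<close> yields \<open>\<rho>\<^sub>i\<close>.
\<close>

text \<open>Each coordinate of a product pmf has its own factor as law. This factor mixes Bernoulli
  laws whose parameter is affine in the noise, so averaging replaces \<open>of_bool w\<close> by its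
  mean \<open>\<rho> $ i\<close>.\<close>

lemma bar_kernel_marginal:
  assumes "(A, A', b, \<rho>) \<in> bar_param_space bmin rmin rmax"
    and "0 < bmin" "0 < rmin" "rmax < 1"
  shows "pmf (map_pmf (\<lambda>v. v $ i) (bar_kernel (A, A', b, \<rho>) u)) True =
    A $ i \<bullet> state_vec u + A' $ i \<bullet> (1 - state_vec u) + \<rho> $ i * b $ i"
proof -
  have "\<rho> $ i \<in> {rmin..rmax}"
    using assms(1) unfolding bar_param_space_def by auto
  then have \<rho>: "0 \<le> \<rho> $ i" "\<rho> $ i \<le> 1"
    using assms(3,4) by auto
  \<comment> \<open>These bounds make the clamping in \<open>bernoulli_pmf\<close> inactive.\<close>
  have s: "0 \<le> bar_success (A, A', b, \<rho>) u i w" "bar_success (A, A', b, \<rho>) u i w \<le> 1" for w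
    using bar_success_bounds [OF assms(1,2), of u i w] by auto
  have "map_pmf (\<lambda>v. v $ i) (bar_kernel (A, A', b, \<rho>) u) =
    bind_pmf (bernoulli_pmf (\<rho> $ i)) (\<lambda>w. bernoulli_pmf (bar_success (A, A', b, \<rho>) u i w))"
    by (simp add: bar_kernel_def map_pmf_comp Pi_pmf_component)
  then show ?thesis
    using \<rho> s by (simp add: pmf_bind bar_success_def algebra_simps)
qed

text \<open>With whole kernels equal, marginals can be compared by projection, without summing
  products.\<close>

lemma bar_transition_vec_eqD:
  assumes "bar_transition_vec \<theta> = bar_transition_vec \<theta>'"
  shows "bar_kernel \<theta> u = bar_kernel \<theta>' u"
proof (rule pmf_eqI)
  fix v
  have "bar_transition_vec \<theta> $ (u, v) = bar_transition_vec \<theta>' $ (u, v)"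
    using assms by simp
  then show "pmf (bar_kernel \<theta> u) v = pmf (bar_kernel \<theta>' u) v"
    by (simp add: bar_transition_vec_def vectorize_def bar_transition_matrix_def)
qed

lemma state_vec_zero: "state_vec (\<chi> k. False) = 0"
  by (simp add: state_vec_def vec_eq_iff)

lemma state_vec_unit: "state_vec (\<chi> k. k = j) = axis j 1"
  by (simp add: state_vec_def vec_eq_iff axis_def)

lemma complementary_nonneg_unique:
  fixes x y x' y' :: real
  assumes "0 \<le> x" "0 \<le> y" "x * y = 0" "0 \<le> x'" "0 \<le> y'" "x' * y' = 0" "x - y = x' - y'"
  shows "x = x' \<and> y = y'"
  using assms by auto

theorem theorem4:
  fixes bmin rmin rmax :: real
  assumes "bmin \<in> {0<..<1}" and "0 < rmin" and "rmin < rmax" and "rmax < 1"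
  shows "inj_on (bar_transition_vec :: 'p::finite bar_param \<Rightarrow> real ^ ((bool ^ 'p) \<times> (bool ^ 'p)))
           (bar_param_space bmin rmin rmax)"
proof (rule inj_onI)
  fix \<theta> \<theta>2 :: "'p bar_param"
  assume mem: "\<theta> \<in> bar_param_space bmin rmin rmax" "\<theta>2 \<in> bar_param_space bmin rmin rmax"
    and eq: "bar_transition_vec \<theta> = bar_transition_vec \<theta>2"
  obtain A A' b \<rho> where \<theta>: "\<theta> = (A, A', b, \<rho>)"
    by (cases \<theta>)
  obtain C C' d \<sigma> where \<theta>2: "\<theta>2 = (C, C', d, \<sigma>)"
    by (cases \<theta>2)
  have bmin: "0 < bmin"
    using assms(1) by simp
  have q: "A $ i \<bullet> state_vec u + A' $ i \<bullet> (1 - state_vec u) + \<rho> $ i * b $ i =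
      C $ i \<bullet> state_vec u + C' $ i \<bullet> (1 - state_vec u) + \<sigma> $ i * d $ i" for i u
    using bar_kernel_marginal [OF mem(1) [unfolded \<theta>] bmin assms(2,4)]
      bar_kernel_marginal [OF mem(2) [unfolded \<theta>2] bmin assms(2,4)]
      bar_transition_vec_eqD [OF eq] unfolding \<theta> \<theta>2 by metis
  have q0: "A' $ i \<bullet> 1 + \<rho> $ i * b $ i = C' $ i \<bullet> 1 + \<sigma> $ i * d $ i" for i
    using q [of i "\<chi> k. False"] by (simp add: state_vec_zero)
  \<comment> \<open>Here \<open>1 - axis j 1\<close> drops only the \<open>j\<close>-th entry from
    the row sum \<open>A' $ i \<bullet> 1\<close>, so subtracting \<open>q0\<close> cancels all the
    rest.\<close>
  have "A $ i $ j - A' $ i $ j = C $ i $ j - C' $ i $ j" for i j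
    using q [of i "\<chi> k. k = j"] q0 [of i]
    by (simp add: state_vec_unit inner_diff_right inner_axis)
  then have "A $ i $ j = C $ i $ j \<and> A' $ i $ j = C' $ i $ j" for i j
    using mem unfolding bar_param_space_def \<theta> \<theta>2
    by (intro complementary_nonneg_unique) auto
  then have A: "A = C" "A' = C'"
    by (simp_all add: vec_eq_iff)
  have row: "(\<Sum>j\<in>UNIV. A $ i $ j + A' $ i $ j) + b $ i = 1"
    "(\<Sum>j\<in>UNIV. C $ i $ j + C' $ i $ j) + d $ i = 1" and "bmin \<le> b $ i" for i
    using mem unfolding bar_param_space_def \<theta> \<theta>2 by auto
  then have b: "b = d" and b_nz: "b $ i \<noteq> 0" for i
    using bmin row unfolding A vec_eq_iff by (smt (verit))+
  have "\<rho> = \<sigma>"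
    using q0 b_nz unfolding A b vec_eq_iff by simp
  then show "\<theta> = \<theta>2"
    by (simp add: \<theta> \<theta>2 A b)
qed

end
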